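(* Let $D\subseteq\mathbb{R}^k$ be an open set with $0\in D$, let $\Omega,S\subseteq D$ with $0\in\Omega$, $0\in S$, let $h:D\to\mathbb{R}^m$ be continuous with $h(0)=0$, and let $f:D\times D\times D\to\mathbb{R}^k$ be locally Lipschitz. For $n\in\mathbb{N}$ let $(\Sigma_n)$ be the string $\dot x_i=f(x_{i-1},x_i,x_{i+1})$, $y_i=h(x_i)$, $i=1,\dots,n$, with $x_0=u\in\Omega$, $x_{n+1}=w\in S$. Suppose that $(\Sigma_n)$ is forward complete for every $n\in\mathbb{N}$. Let $p\in[1,+\infty]$ and suppose that there exist $Q\in C^0(D;\mathbb{R}_+)$ and constants $\gamma,\delta\ge 0$ such that for every $\xi\in D$ and $u,w\in\mho(D)$, the solution of the initial value problem $$\dot x=f(u,x,w),\quad y=h(x),\quad x\in D,\qquad x(0)=\xi$$ exists and satisfies, for all $t\ge 0$, $$\|y\|_{[0,t],p}\le\gamma\|h(u)\|_{[0,t],p}+\delta\|h(w)\|_{[0,t],p}+Q(\xi).$$ If $\gamma+\delta<1$, then the string $(\Sigma_n)_{n\in\mathbb{N}}$ is $L^p$ string stable; moreover, the string stability estimate $$\|y_i\|_{[0,t],p}\le a_1\left(\|h(u)\|_{[0,t],p}\right)+a_2\left(\|h(w)\|_{[0,t],p}\right)+Q_n(\xi)$$ (for all $n\in\mathbb{N}$, $\xi\in D^n$, $u\in\mho(\Omega)$, $w\in\mho(S)$, $t\ge0$, $i=1,\dots,n$, along the solution of $(\Sigma_n)$ with $x(0)=\xi$) holds with $a_1(s)=\frac{\gamma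 s}{1-\gamma-\delta}$, $a_2(s)=\frac{\delta s}{1-\gamma-\delta}$ for all $s\ge 0$ and $Q_n(\xi_1,\dots,\xi_n)=\frac{1}{1-\gamma-\delta}\max_{i=1,\dots,n}Q(\xi_i)$ for all $(\xi_1,\dots,\xi_n)\in D^n$.
   Context: Notation. $\mathbb{R}_+=[0,+\infty)$ and $|\cdot|$ is the Euclidean norm. For a set $A\subseteq\mathbb{R}^q$, $\mho(A)$ is the set of Lebesgue measurable, locally essentially bounded functions $u:\mathbb{R}_+\to A$ such that for every $T>0$ there is a compact set $\Omega_T\subseteq A$ with $u(t)\in\Omega_T$ for almost every $t\in[0,T]$. For a locally essentially bounded measurable signal $y$ on $\mathbb{R}_+$ and $t\ge0$: $\|y\|_{[0,t],p}=\left(\int_0^t|y(s)|^p\,ds\right)^{1/p}$ if $p\in[1,+\infty)$, and $\|y\|_{[0,t],\infty}$ is the (essential) supremum of $|y(s)|$ over $s\in[0,t]$. Forward completeness. The state of $(\Sigma_n)$ is $x=(x_1,\dots,x_n)\in D^n$. The system $(\Sigma_n)$ is forward complete if for every $\xi\in D^n$, $u\in\mho(\Omega)$, $w\in\mho(S)$ the (unique, Carathéodory) solution $x(t)\in D^n$ with $x(0)=\xi$ exists for all $t\ge 0$. $L^p$ string stability. For $p\in[1,+\infty]$, the string $(\Sigma_n)_{n\in\mathbb{N}}$ is $L^p$ string stable if there exist non-decreasing functions $a_1,a_2\in C^0(\mathbb{R}_+;\mathbb{R}_+)$, independent of $n$, such that for every $n\in\mathbb{N}$: (i) $(\Sigma_n)$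 is forward complete, and (ii) there exists $Q_n\in C^0(D^n;\mathbb{R}_+)$ such that for every $\xi\in D^n$, $u\in\mho(\Omega)$, $w\in\mho(S)$ the solution of $(\Sigma_n)$ with $x(0)=\xi$ satisfies, for all $t\ge0$ and $i=1,\dots,n$, $\|y_i\|_{[0,t],p}\le a_1(\|h(u)\|_{[0,t],p})+a_2(\|h(w)\|_{[0,t],p})+Q_n(\xi)$. *)

theory Defs
  imports "HOL-Analysis.Analysis" "HOL-Probability.Essential_Supremum"
begin

definition admissible_signals :: "'a::euclidean_space set \<Rightarrow> (real \<Rightarrow> 'a) set" where
  "admissible_signals A =
    {u. u \<in> borel_measurable (lebesgue_on {0..}) \<and>
        (\<forall>t\<ge>0. u t \<in> A) \<and>
        (\<forall>T>0. \<exists>B. AE t in lebesgue_on {0..T}. norm (u t) \<le> B) \<and>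
        (\<forall>T>0. \<exists>K. compact K \<and> K \<subseteq> A \<and> (AE t in lebesgue_on {0..T}. u t \<in> K))}"

text \<open>
  The seminorm is real-valued: it is meant for measurable, locally essentially bounded signals,
  for which the integral and the essential supremum below are finite.  At \<open>t = 0\<close> the interval is a
  null set and the value is \<open>0\<close> for every \<open>p\<close>.
\<close>

definition Lp_seminorm :: "ereal \<Rightarrow> real \<Rightarrow> (real \<Rightarrow> 'a::euclidean_space) \<Rightarrow> real" where
  "Lp_seminorm p t y =
    (if p = \<infinity> then enn2real (esssup (lebesgue_on {0..t}) (\<lambda>s. ennreal (norm (y s))))
     else (LINT s|lebesgue_on {0..t}. norm (y s) powr real_of_ereal p) powr (1 / real_of_ereal p))"

definition locally_lipschitz_on :: "'a::metric_space set \<Rightarrow> ('a \<Rightarrow> 'b::metric_space) \<Rightarrow> bool" where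
  "locally_lipschitz_on X f \<longleftrightarrow> (\<forall>z\<in>X. \<exists>r>0. \<exists>L. L-lipschitz_on (cball z r \<inter> X) f)"

text \<open>
  Absolute continuity on an interval; a pair \<open>(a, b)\<close> in \<open>P\<close> stands for the subinterval
  with end points \<open>a \<le> b\<close>, and the subintervals do not overlap.
\<close>

definition abs_continuous_on :: "real set \<Rightarrow> (real \<Rightarrow> 'a::real_normed_vector) \<Rightarrow> bool" where
  "abs_continuous_on I x \<longleftrightarrow>
    (\<forall>\<epsilon>>0. \<exists>\<delta>>0. \<forall>P. finite P \<and> (\<forall>(a, b)\<in>P. a \<le> b \<and> {a..b} \<subseteq> I) \<and>
        disjoint_family_on (\<lambda>(a, b). {a<..<b}) P \<and> (\<Sum>(a, b)\<in>P. b - a) < \<delta> \<longrightarrow>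
        (\<Sum>(a, b)\<in>P. norm (x b - x a)) < \<epsilon>)"

text \<open>
  Caratheodory solutions on \<open>[0, \<infinity>)\<close>.  Values of \<open>x\<close> at negative times are irrelevant: the
  derivative is only required at almost every \<open>t\<close>, and \<open>{0}\<close> is a null set.
\<close>

definition system_solution ::
  "'a::euclidean_space set \<Rightarrow> ('a \<times> 'a \<times> 'a \<Rightarrow> 'a) \<Rightarrow> 'a \<Rightarrow> (real \<Rightarrow> 'a) \<Rightarrow> (real \<Rightarrow> 'a) \<Rightarrow>
    (real \<Rightarrow> 'a) \<Rightarrow> bool" where
  "system_solution D f \<xi> u w x \<longleftrightarrow>
    x 0 = \<xi> \<and> (\<forall>t\<ge>0. x t \<in> D) \<and> (\<forall>T>0. abs_continuous_on {0..T} x) \<and>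
    (AE t in lebesgue_on {0..}. (x has_vector_derivative f (u t, x t, w t)) (at t))"

text \<open>
  \<open>D\<^sup>n\<close> is the extensional product over \<open>{1..n}\<close>, with the subspace topology of the product
  topology on \<open>nat \<Rightarrow> 'a\<close>, which is the Euclidean topology of \<open>D\<^sup>n\<close>.
\<close>

abbreviation state_space :: "nat \<Rightarrow> 'a set \<Rightarrow> (nat \<Rightarrow> 'a) set" where
  "state_space n D \<equiv> {1..n} \<rightarrow>\<^sub>E D"

text \<open>\<open>x\<^sub>0 = u\<close> and \<open>x\<^bsub>n+1\<^esub> = w\<close>.\<close>

definition with_ends ::
  "nat \<Rightarrow> (real \<Rightarrow> 'a) \<Rightarrow> (real \<Rightarrow> 'a) \<Rightarrow> (real \<Rightarrow> nat \<Rightarrow> 'a) \<Rightarrow> nat \<Rightarrow> real \<Rightarrow> 'a" where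
  "with_ends n u w x i t = (if i = 0 then u t else if i = n + 1 then w t else x t i)"

definition string_solution ::
  "'a::euclidean_space set \<Rightarrow> ('a \<times> 'a \<times> 'a \<Rightarrow> 'a) \<Rightarrow> nat \<Rightarrow> (nat \<Rightarrow> 'a) \<Rightarrow> (real \<Rightarrow> 'a) \<Rightarrow>
    (real \<Rightarrow> 'a) \<Rightarrow> (real \<Rightarrow> nat \<Rightarrow> 'a) \<Rightarrow> bool" where
  "string_solution D f n \<xi> u w x \<longleftrightarrow>
    x 0 = \<xi> \<and> (\<forall>t\<ge>0. x t \<in> state_space n D) \<and>
    (\<forall>i\<in>{1..n}. \<forall>T>0. abs_continuous_on {0..T} (\<lambda>t. x t i)) \<and>
    (AE t in lebesgue_on {0..}. \<forall>i\<in>{1..n}.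
      ((\<lambda>t. x t i) has_vector_derivative
        f (with_ends n u w x (i - 1) t, with_ends n u w x i t, with_ends n u w x (i + 1) t)) (at t))"

definition string_forward_complete ::
  "'a::euclidean_space set \<Rightarrow> 'a set \<Rightarrow> 'a set \<Rightarrow> ('a \<times> 'a \<times> 'a \<Rightarrow> 'a) \<Rightarrow> nat \<Rightarrow> bool" where
  "string_forward_complete D \<Omega> S f n \<longleftrightarrow>
    (\<forall>\<xi>\<in>state_space n D. \<forall>u\<in>admissible_signals \<Omega>. \<forall>w\<in>admissible_signals S.
      \<exists>x. string_solution D f n \<xi> u w x)"

definition string_estimate ::
  "'a::euclidean_space set \<Rightarrow> 'a set \<Rightarrow> 'a set \<Rightarrow> ('a \<times> 'a \<times> 'a \<Rightarrow> 'a) \<Rightarrow>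
    ('a \<Rightarrow> 'b::euclidean_space) \<Rightarrow> ereal \<Rightarrow> (real \<Rightarrow> real) \<Rightarrow> (real \<Rightarrow> real) \<Rightarrow> nat \<Rightarrow>
    ((nat \<Rightarrow> 'a) \<Rightarrow> real) \<Rightarrow> bool" where
  "string_estimate D \<Omega> S f h p a1 a2 n Qn \<longleftrightarrow>
    (\<forall>\<xi>\<in>state_space n D. \<forall>u\<in>admissible_signals \<Omega>. \<forall>w\<in>admissible_signals S.
      \<forall>x. string_solution D f n \<xi> u w x \<longrightarrow>
        (\<forall>t\<ge>0. \<forall>i\<in>{1..n}.
          Lp_seminorm p t (\<lambda>s. h (x s i)) \<le>
            a1 (Lp_seminorm p t (\<lambda>s. h (u s))) + a2 (Lp_seminorm p t (\<lambda>s. h (w s))) + Qn \<xi>))"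

definition string_stable ::
  "'a::euclidean_space set \<Rightarrow> 'a set \<Rightarrow> 'a set \<Rightarrow> ('a \<times> 'a \<times> 'a \<Rightarrow> 'a) \<Rightarrow>
    ('a \<Rightarrow> 'b::euclidean_space) \<Rightarrow> ereal \<Rightarrow> bool" where
  "string_stable D \<Omega> S f h p \<longleftrightarrow>
    (\<exists>a1 a2.
      continuous_on {0..} a1 \<and> mono_on {0..} a1 \<and> (\<forall>s\<ge>0. 0 \<le> a1 s) \<and>
      continuous_on {0..} a2 \<and> mono_on {0..} a2 \<and> (\<forall>s\<ge>0. 0 \<le> a2 s) \<and>
      (\<forall>n\<ge>1. string_forward_complete D \<Omega> S f n \<and>
        (\<exists>Qn. continuous_on (state_space n D) Qn \<and> (\<forall>\<xi>\<in>state_space n D. 0 \<le> Qn \<xi>) \<and>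
          string_estimate D \<Omega> S f h p a1 a2 n Qn)))"

end

theory Submission
  imports Defs
begin

text \<open>
  Each vehicle is driven by the trajectories of its neighbours, which are admissible inputs because
  they are continuous. The hypothesis therefore bounds the \<open>i\<close>-th output norm \<open>b\<^sub>i\<close> by
  \<open>\<gamma> b\<^bsub>i-1\<^esub> + \<delta> b\<^bsub>i+1\<^esub> + Q(\<xi>\<^sub>i)\<close>. At an index where \<open>b\<^sub>i\<close> attains its maximum \<open>M\<close> over \<open>{1..n}\<close>, the
  neighbours are at most \<open>M + b\<^sub>0\<close> and \<open>M + b\<^bsub>n+1\<^esub>\<close>, and the resulting inequality is solved for \<open>M\<close>.
\<close>

lemma Lp_seminorm_nonneg: "0 \<le> Lp_seminorm p t y"
  by (simp add: Lp_seminorm_def)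

lemma abs_continuous_on_imp_continuous_on:
  assumes "abs_continuous_on {a..b} x"
  shows "continuous_on {a..b} x"
  unfolding continuous_on_iff
proof (intro ballI allI impI)
  fix s and e :: real
  assume s: "s \<in> {a..b}" and "e > 0"
  then obtain d where "d > 0" and
    d: "\<And>P. finite P \<and> (\<forall>(a', b')\<in>P. a' \<le> b' \<and> {a'..b'} \<subseteq> {a..b}) \<and>
        disjoint_family_on (\<lambda>(a, b). {a<..<b}) P \<and> (\<Sum>(a, b)\<in>P. b - a) < d \<Longrightarrow>
        (\<Sum>(a, b)\<in>P. norm (x b - x a)) < e"
    using assms unfolding abs_continuous_on_def by blast
  \<comment> \<open>A family with a single interval turns absolute continuity into uniform
    continuity. Intervals are ordered pairs, hence the later case split on which of \<open>s\<close>
    and \<open>t\<close> comes first.\<close>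
  have *: "dist (x r) (x q) < e" if "q \<in> {a..b}" "r \<in> {a..b}" "q \<le> r" "r - q < d" for q r
    using d[of "{(q, r)}"] that by (auto simp: dist_norm disjoint_family_on_def)
  show "\<exists>d>0. \<forall>t\<in>{a..b}. dist t s < d \<longrightarrow> dist (x t) (x s) < e"
  proof (intro exI conjI ballI impI)
    fix t assume "t \<in> {a..b}" "dist t s < d"
    then show "dist (x t) (x s) < e"
      using *[of s t] *[of t s] s by (cases "s \<le> t") (auto simp: dist_real_def dist_commute)
  qed fact
qed

lemma continuous_on_atLeast_if_Icc:
  fixes x :: "real \<Rightarrow> 'a::topological_space"
  assumes "\<And>T. T > a \<Longrightarrow> continuous_on {a..T} x"
  shows "continuous_on {a..} x"
  unfolding continuous_on_eq_continuous_within
proof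
  fix s assume s: "s \<in> {a..}"
  \<comment> \<open>The right end \<open>s + 1\<close> lies strictly beyond \<open>s\<close>, so
    \<open>{a..s + 1}\<close> contains a neighbourhood of \<open>s\<close> relative to
    \<open>{a..}\<close>.\<close>
  have "at s within {a..} = at s within {a..s + 1}"
    by (rule at_within_nhd[of _ "{..<s + 1}"]) auto
  then show "continuous (at s within {a..}) x"
    using assms[of "s + 1"] s
    by (auto simp: continuous_on_eq_continuous_within continuous_within)
qed

lemma admissible_signals_mono:
  assumes "A \<subseteq> B"
  shows "admissible_signals A \<subseteq> admissible_signals B"
  using assms unfolding admissible_signals_def by (blast dest: order_trans)

text \<open>The image of \<open>{0..T}\<close> is compact and lies in \<open>A\<close>, so it serves
  as the required compact set, and its boundedness gives the local essential bound.\<close>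

lemma continuous_on_imp_admissible_signals:
  fixes x :: "real \<Rightarrow> 'a::euclidean_space"
  assumes cont: "continuous_on {0..} x" and "\<And>t. t \<ge> 0 \<Longrightarrow> x t \<in> A"
  shows "x \<in> admissible_signals A"
proof -
  have compact: "compact (x ` {0..T})" for T
    by (intro compact_continuous_image continuous_on_subset[OF cont]) auto
  have AE_Icc: "AE t in lebesgue_on {0..T}. x t \<in> x ` {0..T}" for T
    by (rule AE_I2) (auto simp: space_restrict_space)
  have "\<exists>B. AE t in lebesgue_on {0..T}. norm (x t) \<le> B" for T
  proof -
    obtain B where "\<And>v. v \<in> x ` {0..T} \<Longrightarrow> norm v \<le> B"
      using compact_imp_bounded[OF compact] unfolding bounded_iff by blast
    then show ?thesis
      using AE_Icc[of T] by (intro exI[of _ B]) (auto elim: eventually_mono)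
  qed
  moreover have "x \<in> borel_measurable (lebesgue_on {0..})"
    by (intro continuous_imp_measurable_on_sets_lebesgue cont) auto
  moreover have "x ` {0..T} \<subseteq> A" for T
    using assms by auto
  ultimately show ?thesis
    using assms(2) compact AE_Icc unfolding admissible_signals_def mem_Collect_eq
    by (intro conjI allI impI exI[of _ "x ` {0..T}" for T])
qed

lemma continuous_on_Max_image:
  fixes g :: "'i \<Rightarrow> 'a::topological_space \<Rightarrow> 'b::linorder_topology"
  assumes "finite I" "I \<noteq> {}" "\<And>i. i \<in> I \<Longrightarrow> continuous_on A (g i)"
  shows "continuous_on A (\<lambda>x. Max ((\<lambda>i. g i x) ` I))"
  using assms
proof (induction I rule: finite_ne_induct)
  case (insert i I)
  then have "(\<lambda>x. Max ((\<lambda>i. g i x) ` insert i I)) = (\<lambda>x. max (g i x) (Max ((\<lambda>i. g i x) ` I)))"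
    by auto
  with insert show ?case
    by (auto intro: continuous_on_max)
qed simp

lemma gain_chain_bound:
  fixes b q :: "nat \<Rightarrow> real" and \<gamma> \<delta> :: real
  assumes "0 \<le> \<gamma>" "0 \<le> \<delta>" "\<gamma> + \<delta> < 1"
    and nonneg: "\<And>i. 0 \<le> b i"
    and step: "\<And>i. i \<in> {1..n} \<Longrightarrow> b i \<le> \<gamma> * b (i - 1) + \<delta> * b (i + 1) + q i"
    and i: "i \<in> {1..n}"
  shows "b i \<le> (\<gamma> * b 0 + \<delta> * b (n + 1) + Max (q ` {1..n})) / (1 - \<gamma> - \<delta>)"
proof -
  define M where "M = Max (b ` {1..n})"
  have le_M: "b j \<le> M" if "j \<in> {1..n}" for j
    using that by (simp add: M_def)
  have "M \<in> b ` {1..n}"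
    using i unfolding M_def by (intro Max_in) auto
  then obtain j where j: "j \<in> {1..n}" and M: "M = b j"
    by blast
  have "0 \<le> M"
    using nonneg M by simp
  \<comment> \<open>The left neighbour is either the end value \<open>b 0\<close> or one of the
    values bounded by \<open>M\<close>. As both are nonnegative, their sum covers either case; the
    right neighbour is treated in the same way with \<open>b (n + 1)\<close>.\<close>
  have "b (j - 1) \<le> M + b 0"
  proof (cases "j = 1")
    case False
    then have "j - 1 \<in> {1..n}"
      using j by auto
    with le_M nonneg[of 0] show ?thesis
      by fastforce
  qed (use \<open>0 \<le> M\<close> in simp)
  moreover have "b (j + 1) \<le> M + b (n + 1)"
    using le_M[of "j + 1"] \<open>0 \<le> M\<close> nonneg[of "n + 1"] j by (cases "j = n") auto
  moreover have "q j \<le> Max (q ` {1..n})"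
    using j by simp
  ultimately have "M \<le> \<gamma> * (M + b 0) + \<delta> * (M + b (n + 1)) + Max (q ` {1..n})"
    using step[OF j] assms(1,2) unfolding M by (smt (verit) mult_left_mono)
  \<comment> \<open>The terms \<open>\<gamma> * M\<close> and \<open>\<delta> * M\<close> move to
    the left, and the small-gain condition makes the remaining factor positive.\<close>
  then have "M * (1 - \<gamma> - \<delta>) \<le> \<gamma> * b 0 + \<delta> * b (n + 1) + Max (q ` {1..n})"
    by (simp add: algebra_simps)
  then have "M \<le> (\<gamma> * b 0 + \<delta> * b (n + 1) + Max (q ` {1..n})) / (1 - \<gamma> - \<delta>)"
    using assms(3) by (simp add: pos_le_divide_eq)
  with le_M[OF i] show ?thesis
    by linarith
qed

text \<open>Makes the signals at both neighbours of a vehicle legitimate inputs of the single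
  system. An inner component is continuous on every \<open>{0..T}\<close>, hence on
  \<open>{0..}\<close>, and stays in \<open>D\<close>.\<close>

lemma with_ends_admissible:
  assumes x: "string_solution D f n \<xi> u w x"
    and "u \<in> admissible_signals D" "w \<in> admissible_signals D" and "i \<le> n + 1"
  shows "with_ends n u w x i \<in> admissible_signals D"
proof -
  consider "i = 0" | "i = n + 1" | "i \<in> {1..n}"
    using assms(4) by fastforce
  then show ?thesis
  proof cases
    case 3
    have "with_ends n u w x i = (\<lambda>t. x t i)"
      using 3 by (auto simp: with_ends_def fun_eq_iff)
    moreover have "continuous_on {0..} (\<lambda>t. x t i)"
      using x 3 unfolding string_solution_def
      by (blast intro: continuous_on_atLeast_if_Icc abs_continuous_on_imp_continuous_on)
    moreover have "x t i \<in> D" if "t \<ge> 0" for t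
      using x 3 that unfolding string_solution_def by (blast dest: PiE_mem)
    ultimately show ?thesis
      by (simp add: continuous_on_imp_admissible_signals)
  qed (use assms in \<open>auto simp: with_ends_def[abs_def]\<close>)
qed

text \<open>One null set serves all components, since the quantifier over \<open>i\<close> stands
  inside the almost-everywhere statement; fixing \<open>i\<close> leaves the equation of a single
  system driven by its neighbours.\<close>

lemma string_solution_component:
  assumes x: "string_solution D f n \<xi> u w x" and i: "i \<in> {1..n}"
  shows "system_solution D f (\<xi> i) (with_ends n u w x (i - 1)) (with_ends n u w x (i + 1))
    (with_ends n u w x i)"
proof -
  have eq: "with_ends n u w x i = (\<lambda>t. x t i)"
    using i by (auto simp: with_ends_def fun_eq_iff)
  have "AE t in lebesgue_on {0..}. \<forall>i\<in>{1..n}. ((\<lambda>t. x t i) has_vector_derivative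
      f (with_ends n u w x (i - 1) t, with_ends n u w x i t, with_ends n u w x (i + 1) t)) (at t)"
    using x unfolding string_solution_def by blast
  then have "AE t in lebesgue_on {0..}. ((\<lambda>t. x t i) has_vector_derivative
      f (with_ends n u w x (i - 1) t, with_ends n u w x i t, with_ends n u w x (i + 1) t)) (at t)"
    by (rule eventually_mono) (use i in blast)
  moreover have "x t i \<in> D" if "t \<ge> 0" for t
    using x i that unfolding string_solution_def by (blast dest: PiE_mem)
  ultimately show ?thesis
    using x i unfolding system_solution_def string_solution_def eq by auto
qed

theorem theorem1:
  fixes D \<Omega> S :: "(real ^ 'k) set"
    and h :: "real ^ 'k \<Rightarrow> real ^ 'm"
    and f :: "(real ^ 'k) \<times> (real ^ 'k) \<times> (real ^ 'k) \<Rightarrow> real ^ 'k"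
    and p :: ereal and Q :: "real ^ 'k \<Rightarrow> real" and \<gamma> \<delta> :: real
  assumes "open D" and "0 \<in> D"
    and "\<Omega> \<subseteq> D" and "S \<subseteq> D" and "0 \<in> \<Omega>" and "0 \<in> S"
    and "continuous_on D h" and "h 0 = 0"
    and "locally_lipschitz_on (D \<times> D \<times> D) f"
    and "\<And>n. n \<ge> 1 \<Longrightarrow> string_forward_complete D \<Omega> S f n"
    and "1 \<le> p"
    and "continuous_on D Q" and "\<And>\<xi>. \<xi> \<in> D \<Longrightarrow> 0 \<le> Q \<xi>"
    and "0 \<le> \<gamma>" and "0 \<le> \<delta>"
    and "\<And>\<xi> u w. \<xi> \<in> D \<Longrightarrow> u \<in> admissible_signals D \<Longrightarrow> w \<in> admissible_signals D \<Longrightarrow>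
      (\<exists>x. system_solution D f \<xi> u w x) \<and>
      (\<forall>x. system_solution D f \<xi> u w x \<longrightarrow>
        (\<forall>t\<ge>0. Lp_seminorm p t (\<lambda>s. h (x s)) \<le>
          \<gamma> * Lp_seminorm p t (\<lambda>s. h (u s)) + \<delta> * Lp_seminorm p t (\<lambda>s. h (w s)) + Q \<xi>))"
    and "\<gamma> + \<delta> < 1"
  shows "string_stable D \<Omega> S f h p \<and>
    (\<forall>n\<ge>1. string_estimate D \<Omega> S f h p
      (\<lambda>s. \<gamma> * s / (1 - \<gamma> - \<delta>)) (\<lambda>s. \<delta> * s / (1 - \<gamma> - \<delta>)) n
      (\<lambda>\<xi>. 1 / (1 - \<gamma> - \<delta>) * Max ((\<lambda>i. Q (\<xi> i)) ` {1..n})))"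
proof -
  let ?g = "1 - \<gamma> - \<delta>"
  let ?a1 = "\<lambda>s. \<gamma> * s / ?g" and ?a2 = "\<lambda>s. \<delta> * s / ?g"
  let ?Q = "\<lambda>n \<xi>. 1 / ?g * Max ((\<lambda>i. Q (\<xi> i)) ` {1..n})"
  have g: "0 < ?g"
    using \<open>\<gamma> + \<delta> < 1\<close> by simp
  \<comment> \<open>For \<open>n = 0\<close> the estimate is vacuous, because \<open>{1..n}\<close>
    is empty.\<close>
  have estimate: "string_estimate D \<Omega> S f h p ?a1 ?a2 n (?Q n)" for n
    unfolding string_estimate_def
  proof (intro ballI allI impI)
    fix \<xi> u w x and t :: real and i
    assume \<xi>: "\<xi> \<in> state_space n D"
      and u: "u \<in> admissible_signals \<Omega>" and w: "w \<in> admissible_signals S"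
      and x: "string_solution D f n \<xi> u w x" and "t \<ge> 0" and i: "i \<in> {1..n}"
    define b where "b j = Lp_seminorm p t (\<lambda>s. h (with_ends n u w x j s))" for j
    \<comment> \<open>The single-system hypothesis takes inputs in \<open>D\<close>, whereas the end
      signals are given in the subsets \<open>\<Omega>\<close> and \<open>S\<close>.\<close>
    have uw: "u \<in> admissible_signals D" "w \<in> admissible_signals D"
      using u w admissible_signals_mono \<open>\<Omega> \<subseteq> D\<close> \<open>S \<subseteq> D\<close> by blast+
    have "b j \<le> \<gamma> * b (j - 1) + \<delta> * b (j + 1) + Q (\<xi> j)" if j: "j \<in> {1..n}" for j
    proof -
      have "\<xi> j \<in> D"
        using \<xi> j by (rule PiE_mem)
      moreover have "with_ends n u w x (j - 1) \<in> admissible_signals D"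
        "with_ends n u w x (j + 1) \<in> admissible_signals D"
        using j by (auto intro!: with_ends_admissible[OF x uw])
      \<comment> \<open>The single-system estimate is stated for every solution, so it applies
        directly to the \<open>j\<close>-th component.\<close>
      ultimately show ?thesis
        using assms(16) string_solution_component[OF x j] \<open>t \<ge> 0\<close> unfolding b_def by blast
    qed
    then have "b i \<le> (\<gamma> * b 0 + \<delta> * b (n + 1) + Max ((\<lambda>i. Q (\<xi> i)) ` {1..n})) / ?g"
      using i \<open>0 \<le> \<gamma>\<close> \<open>0 \<le> \<delta>\<close> \<open>\<gamma> + \<delta> < 1\<close>
      by (intro gain_chain_bound) (auto simp: b_def Lp_seminorm_nonneg)
    moreover have "b 0 = Lp_seminorm p t (\<lambda>s. h (u s))"
      "b (n + 1) = Lp_seminorm p t (\<lambda>s. h (w s))" "b i = Lp_seminorm p t (\<lambda>s. h (x s i))"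
      using i by (auto simp: b_def with_ends_def)
    ultimately show "Lp_seminorm p t (\<lambda>s. h (x s i)) \<le>
        ?a1 (Lp_seminorm p t (\<lambda>s. h (u s))) + ?a2 (Lp_seminorm p t (\<lambda>s. h (w s))) + ?Q n \<xi>"
      by (simp add: add_divide_distrib)
  qed
  have Q_continuous: "continuous_on (state_space n D) (?Q n)" if "n \<ge> 1" for n
  proof -
    \<comment> \<open>Evaluation at \<open>i\<close> is continuous in the product topology and maps
      the state space into \<open>D\<close>, where \<open>Q\<close> is continuous.\<close>
    have "continuous_on (state_space n D) (\<lambda>\<xi>. Q (\<xi> i))" if "i \<in> {1..n}" for i
      using that
      by (intro continuous_on_compose2[OF \<open>continuous_on D Q\<close>] continuous_on_product_coordinates
          continuous_on_subset[OF continuous_on_product_coordinates]) auto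
    then show ?thesis
      using that by (intro continuous_on_mult continuous_on_const continuous_on_Max_image) auto
  qed
  have Q_nonneg: "0 \<le> ?Q n \<xi>" if "n \<ge> 1" and "\<xi> \<in> state_space n D" for n \<xi>
  proof -
    \<comment> \<open>Since \<open>n \<ge> 1\<close>, the index \<open>1\<close> is present, and a
      single nonnegative entry already makes the maximum nonnegative.\<close>
    have "0 \<le> Q (\<xi> 1)"
      using that by (intro assms(13)) (auto dest: PiE_mem)
    also have "\<dots> \<le> Max ((\<lambda>i. Q (\<xi> i)) ` {1..n})"
      using that(1) by (intro Max_ge) auto
    finally show ?thesis
      using g by simp
  qed
  have "continuous_on {0..} ?a1" "continuous_on {0..} ?a2"
    using g by (auto intro!: continuous_intros)
  moreover have "mono_on {0..} ?a1" "mono_on {0..} ?a2"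
    using g \<open>0 \<le> \<gamma>\<close> \<open>0 \<le> \<delta>\<close>
    by (auto intro!: mono_onI divide_right_mono mult_left_mono)
  moreover have "\<forall>s\<ge>0. 0 \<le> ?a1 s" "\<forall>s\<ge>0. 0 \<le> ?a2 s"
    using g \<open>0 \<le> \<gamma>\<close> \<open>0 \<le> \<delta>\<close> by simp_all
  \<comment> \<open>The gains \<open>?a1\<close> and \<open>?a2\<close> are the same for all
    \<open>n\<close>; only the offset \<open>?Q n\<close> varies with the length of the
    string.\<close>
  moreover have "string_forward_complete D \<Omega> S f n \<and>
      (\<exists>Qn. continuous_on (state_space n D) Qn \<and> (\<forall>\<xi>\<in>state_space n D. 0 \<le> Qn \<xi>) \<and>
        string_estimate D \<Omega> S f h p ?a1 ?a2 n Qn)" if "n \<ge> 1" for n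
    by (intro conjI exI[of _ "?Q n"] ballI assms(10) Q_continuous Q_nonneg estimate that)
  ultimately have "string_stable D \<Omega> S f h p"
    unfolding string_stable_def
    by (intro exI[of _ ?a1] exI[of _ ?a2] conjI allI impI) simp_all
  with estimate show ?thesis
    by simp
qed

end
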